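(* Let $S$ be a semiring and $G$ a cancellative torsion-free commutative monoid. Then the following statements are equivalent: (1) $c(fg)\subseteq c(f)c(g)\subseteq\sqrt{c(fg)}$ for all $f,g\in S[G]$; (2) $\sqrt I$ is subtractive for each ideal $I$ of the semiring $S$; (3) each prime ideal $\mathbf p$ of $S$ is subtractive.
   Context: A semiring is a set $S$ with operations $+,\cdot$ such that $(S,+)$ is a commutative monoid with identity $0$, $(S,\cdot)$ is a commutative monoid with identity $1\neq 0$, multiplication distributes over addition, and $s\cdot 0=0$ for all $s\in S$. A commutative monoid $G$ (written additively) is cancellative if $a+b=a+c$ implies $b=c$, and torsion-free if $na=nb$ with $n\geq 1$ implies $a=b$. $S[G]$ is the monoid semiring (finite formal sums $\sum s_iX^{g_i}$ with $X^gX^h=X^{g+h}$). For $f=s_1X^{g_1}+\cdots+s_nX^{g_n}\in S[G]$ (distinct $g_i$), $c(f)$ is the ideal $(s_1,\dots,s_n)$ of $S$ generated by the coefficients. An ideal of $S$ is a nonempty subset closed under addition and under multiplication by elements of $S$; it is subtractive if $a+b\in I$ and $a\in I$ imply $b\in I$. A proper ideal $\mathbf p$ is prime if $ab\in\mathbf p$ implies $a\in\mathbf p$ or $b\in\mathbf p$. $\sqrt I=\{s\in S: s^n\in I\text{ for some }n\geq 1\}$. The product of ideals $IJ$ is the ideal of finite sums of products $ab$ with $a\in I$, $b\in J$.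
   Formalization: The monoid G is assumed to have a nonzero element: for G = {0} statement (1) holds for every semiring, while for S = ℕ the prime ideal ℕ∖{1} is not subtractive, so the equivalence as stated fails. *)

theory Defs
  imports Main "HOL.Hull" "HOL-Library.Poly_Mapping"
begin

text \<open>
  A commutative semiring with \<open>1 \<noteq> 0\<close> is a type of class \<^class>\<open>comm_semiring_1\<close>. The monoid
  semiring \<open>S[G]\<close> is the type \<open>'g \<Rightarrow>\<^sub>0 's\<close> of finitely supported functions, with the convolution
  product of \<^theory>\<open>HOL-Library.Poly_Mapping\<close>.

  A cancellative commutative monoid is a type of sort \<open>{comm_monoid_add, cancel_semigroup_add}\<close>.
  The class \<^class>\<open>cancel_comm_monoid_add\<close> is avoided on purpose: it also demands a
  subtraction with \<open>a - b - c = a - (b + c)\<close> for all \<open>a\<close>, \<open>b\<close>, \<open>c\<close>, which is extra structure.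
\<close>

definition torsion_free_monoid :: "'g::comm_monoid_add itself \<Rightarrow> bool" where
  "torsion_free_monoid _ \<longleftrightarrow>
     (\<forall>n\<ge>1. \<forall>a b :: 'g. (\<Sum>i<(n::nat). a) = (\<Sum>i<n. b) \<longrightarrow> a = b)"

definition semiring_ideal :: "'s::comm_semiring_1 set \<Rightarrow> bool" where
  "semiring_ideal I \<longleftrightarrow>
     I \<noteq> {} \<and> (\<forall>a\<in>I. \<forall>b\<in>I. a + b \<in> I) \<and> (\<forall>s. \<forall>a\<in>I. s * a \<in> I)"

definition subtractive :: "'s::comm_semiring_1 set \<Rightarrow> bool" where
  "subtractive I \<longleftrightarrow> (\<forall>a b. a + b \<in> I \<and> a \<in> I \<longrightarrow> b \<in> I)"

definition semiring_prime_ideal :: "'s::comm_semiring_1 set \<Rightarrow> bool" where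
  "semiring_prime_ideal P \<longleftrightarrow>
     semiring_ideal P \<and> P \<noteq> UNIV \<and> (\<forall>a b. a * b \<in> P \<longrightarrow> a \<in> P \<or> b \<in> P)"

definition ideal_radical :: "'s::comm_semiring_1 set \<Rightarrow> 's set" where
  "ideal_radical I = {s. \<exists>n\<ge>1. s ^ n \<in> I}"

definition ideal_product :: "'s::comm_semiring_1 set \<Rightarrow> 's set \<Rightarrow> 's set" where
  "ideal_product I J =
     {\<Sum>i<n. a i * b i | (n::nat) a b. \<forall>i<n. a i \<in> I \<and> b i \<in> J}"

text \<open>The hull is the smallest ideal containing the given elements; in particular the content
  of \<open>0\<close> is the zero ideal.\<close>

definition content_ideal :: "('g \<Rightarrow>\<^sub>0 's::comm_semiring_1) \<Rightarrow> 's set" where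
  "content_ideal f = semiring_ideal hull (Poly_Mapping.lookup f ` Poly_Mapping.keys f)"

end

theory Submission
  imports Defs
begin

text \<open>
  The radical of an ideal is the intersection of the primes above it, which gives the equivalence
  of (2) and (3).

  (3) implies (1): if a prime \<open>P\<close> contains \<open>c(fg)\<close> but not \<open>c(f)c(g)\<close>, the supports of \<open>f\<close> and
  \<open>g\<close> modulo \<open>P\<close> are nonempty finite subsets of \<open>G\<close>. These have a pair of elements whose sum is
  not obtained from any other pair, and subtractivity of \<open>P\<close> puts the product of the two
  corresponding coefficients into \<open>P\<close>. The pair consists of the minima for a translation-invariant
  order on \<open>G\<close> that is total on the finitely many elements involved.

  (1) implies (3): if \<open>a\<close> and \<open>a + b\<close> lie in the prime \<open>P\<close> and \<open>g \<noteq> 0\<close>, then in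
  \<open>(b + a X\<^sup>g) ((a + b) + b X\<^sup>g) = b (a + b) + (b (a + b) + a\<^sup>2) X\<^sup>g + a b X\<^sup>2\<^sup>g\<close>
  all coefficients on the right are in \<open>P\<close>, hence so is \<open>b\<^sup>2\<close>.
\<close>

section \<open>Ideals of semirings\<close>

lemma semiring_idealD:
  assumes "semiring_ideal I"
  shows semiring_ideal_add: "a \<in> I \<Longrightarrow> b \<in> I \<Longrightarrow> a + b \<in> I"
    and semiring_ideal_mult_left: "a \<in> I \<Longrightarrow> s * a \<in> I"
    and semiring_ideal_mult_right: "a \<in> I \<Longrightarrow> a * s \<in> I"
  using assms by (auto simp: semiring_ideal_def mult.commute[of _ s])

lemma semiring_ideal_zero:
  assumes "semiring_ideal I"
  shows "0 \<in> I"
proof -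
  obtain a where "a \<in> I"
    using assms by (auto simp: semiring_ideal_def)
  then show ?thesis
    using semiring_ideal_mult_left[OF assms, of a 0] by simp
qed

lemma semiring_ideal_sum:
  assumes "semiring_ideal I" and "\<And>x. x \<in> A \<Longrightarrow> h x \<in> I"
  shows "sum h A \<in> I"
  using assms(2)
  by (induction A rule: infinite_finite_induct)
    (auto simp: semiring_ideal_zero[OF assms(1)] semiring_ideal_add[OF assms(1)])

lemma semiring_ideal_Inter:
  assumes "\<And>I. I \<in> \<I> \<Longrightarrow> semiring_ideal I"
  shows "semiring_ideal (\<Inter>\<I>)"
proof -
  have "0 \<in> \<Inter>\<I>"
    using assms semiring_ideal_zero by blast
  then show ?thesis
    unfolding semiring_ideal_def
    using assms semiring_ideal_add semiring_ideal_mult_left by blast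
qed

lemma semiring_ideal_hull: "semiring_ideal (semiring_ideal hull X)"
  by (rule hull_in) (auto intro: semiring_ideal_Inter)

section \<open>Radicals and prime ideals\<close>

lemma semiring_prime_ideal_power:
  assumes "semiring_prime_ideal P" and "x ^ n \<in> P" and "n \<ge> 1"
  shows "x \<in> P"
  using assms(3,2)
proof (induction n rule: dec_induct)
  case (step n)
  then have "x \<in> P \<or> x ^ n \<in> P"
    using assms(1) by (auto simp: semiring_prime_ideal_def)
  then show ?case
    using step.IH by blast
qed simp

lemma ideal_radical_prime:
  assumes "semiring_prime_ideal P"
  shows "ideal_radical P = P"
proof (intro set_eqI iffI)
  show "x \<in> P" if "x \<in> ideal_radical P" for x
    using that semiring_prime_ideal_power[OF assms] by (auto simp: ideal_radical_def)
  show "x \<in> ideal_radical P" if "x \<in> P" for x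
    unfolding ideal_radical_def using that by (auto intro!: exI[of _ 1])
qed

lemma ideal_radical_mono: "I \<subseteq> J \<Longrightarrow> ideal_radical I \<subseteq> ideal_radical J"
  by (auto simp: ideal_radical_def)

text \<open>This is the ideal generated by \<open>M\<close> and \<open>a\<close>, the enlargement
  against which the maximality of \<open>M\<close> is tested below.\<close>

lemma semiring_ideal_add_principal:
  assumes "semiring_ideal M"
  shows "semiring_ideal {m + s * a | m s. m \<in> M}"
  unfolding semiring_ideal_def
proof (intro conjI ballI allI)
  show "{m + s * a | m s. m \<in> M} \<noteq> {}"
    using semiring_ideal_zero[OF assms] by blast
next
  fix x y assume "x \<in> {m + s * a | m s. m \<in> M}" "y \<in> {m + s * a | m s. m \<in> M}"
  then obtain m s m' s' where "x = m + s * a" "m \<in> M" "y = m' + s' * a" "m' \<in> M"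
    by blast
  then have "x + y = (m + m') + (s + s') * a \<and> m + m' \<in> M"
    by (simp add: algebra_simps semiring_ideal_add[OF assms])
  then show "x + y \<in> {m + s * a | m s. m \<in> M}"
    by blast
next
  fix t x assume "x \<in> {m + s * a | m s. m \<in> M}"
  then obtain m s where "x = m + s * a" "m \<in> M"
    by blast
  then have "t * x = t * m + (t * s) * a \<and> t * m \<in> M"
    by (simp add: algebra_simps semiring_idealD[OF assms])
  then show "t * x \<in> {m + s * a | m s. m \<in> M}"
    by blast
qed

text \<open>Krull's argument: Zorn's lemma gives an ideal maximal among those above \<open>I\<close>
  that contain no positive power of \<open>x\<close>, and such an ideal is prime. Only sums and
  products occur, so the proof for rings carries over.\<close>

lemma prime_ideal_avoiding:
  fixes I :: "'s::comm_semiring_1 set"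
  assumes I: "semiring_ideal I" and x: "x \<notin> ideal_radical I"
  obtains P where "semiring_prime_ideal P" "I \<subseteq> P" "x \<notin> P"
proof -
  define \<A> where "\<A> = {J. semiring_ideal J \<and> I \<subseteq> J \<and> (\<forall>n\<ge>1. x ^ n \<notin> J)}"
  have "I \<in> \<A>"
    using I x by (auto simp: \<A>_def ideal_radical_def)
  moreover have "\<Union>\<C> \<in> \<A>" if "\<C> \<noteq> {}" and chain: "subset.chain \<A> \<C>" for \<C>
  proof -
    have sub: "\<C> \<subseteq> \<A>"
      using chain by (simp add: subset.chain_def)
    have "a + b \<in> \<Union>\<C>" if a: "a \<in> \<Union>\<C>" and b: "b \<in> \<Union>\<C>" for a b
    proof -
      obtain J K where J: "a \<in> J" "J \<in> \<C>" and K: "b \<in> K" "K \<in> \<C>"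
        using a b by blast
      then have "J \<subseteq> K \<or> K \<subseteq> J"
        using chain by (auto simp: subset_chain_def)
      then obtain L where L: "L \<in> \<C>" "a \<in> L" "b \<in> L"
        using J K by blast
      then have "semiring_ideal L"
        using sub by (auto simp: \<A>_def)
      then show ?thesis
        using L semiring_ideal_add by blast
    qed
    moreover have "s * a \<in> \<Union>\<C>" if "a \<in> \<Union>\<C>" for s a
      using that sub semiring_ideal_mult_left unfolding \<A>_def by blast
    moreover have "I \<subseteq> \<Union>\<C>"
      using \<open>\<C> \<noteq> {}\<close> sub unfolding \<A>_def by blast
    moreover have "I \<noteq> {}"
      using semiring_ideal_zero[OF I] by blast
    ultimately have "semiring_ideal (\<Union>\<C>)"
      unfolding semiring_ideal_def by blast
    then show ?thesis
      using sub \<open>I \<subseteq> \<Union>\<C>\<close> unfolding \<A>_def by blast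
  qed
  ultimately obtain M where "M \<in> \<A>" and max: "\<And>J. J \<in> \<A> \<Longrightarrow> M \<subseteq> J \<Longrightarrow> J = M"
    using subset_Zorn_nonempty[of \<A>] by blast
  then have M: "semiring_ideal M" and "I \<subseteq> M" and pow: "\<And>n. n \<ge> 1 \<Longrightarrow> x ^ n \<notin> M"
    by (auto simp: \<A>_def)
  have "x \<notin> M"
    using pow[of 1] by simp
  \<comment> \<open>Enlarging \<open>M\<close> by an element outside it must leave
    \<open>\<A>\<close>, and the only way to do so is to pick up a power of
    \<open>x\<close>.\<close>
  have power_above: "\<exists>n m s. n \<ge> 1 \<and> m \<in> M \<and> x ^ n = m + s * a" if "a \<notin> M" for a
  proof -
    let ?J = "{m + s * a | m s. m \<in> M}"
    have "M \<subseteq> ?J"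
    proof
      fix m assume "m \<in> M"
      then have "m = m + 0 * a \<and> m \<in> M" by simp
      then show "m \<in> ?J" by blast
    qed
    moreover have "a \<in> ?J"
    proof -
      have "a = 0 + 1 * a \<and> 0 \<in> M"
        using semiring_ideal_zero[OF M] by simp
      then show ?thesis by blast
    qed
    ultimately have "?J \<notin> \<A>"
      using max[of ?J] that by blast
    then have "\<not> (\<forall>n\<ge>1. x ^ n \<notin> ?J)"
      using \<open>I \<subseteq> M\<close> \<open>M \<subseteq> ?J\<close> semiring_ideal_add_principal[OF M, of a] unfolding \<A>_def by blast
    then show ?thesis by blast
  qed
  have "a \<in> M \<or> b \<in> M" if ab: "a * b \<in> M" for a b
  proof (rule ccontr)
    assume "\<not> (a \<in> M \<or> b \<in> M)"
    then obtain n m s n' m' s'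
      where *: "n \<ge> 1" "m \<in> M" "x ^ n = m + s * a" "m' \<in> M" "x ^ n' = m' + s' * b"
      using power_above[of a] power_above[of b] by blast
    \<comment> \<open>The product of the two representations is grouped so that every summand has a
      factor \<open>m\<close>, \<open>m'\<close> or \<open>a * b\<close> in
      \<open>M\<close>.\<close>
    have "x ^ (n + n') = m * (m' + s' * b) + ((s * a) * m' + (s * s') * (a * b))"
      by (simp add: power_add *(3,5) algebra_simps)
    also have "\<dots> \<in> M"
      using ab *(2,4) by (simp add: semiring_idealD[OF M])
    finally show False
      using pow[of "n + n'"] *(1) by simp
  qed
  then have "semiring_prime_ideal M"
    using M \<open>x \<notin> M\<close> by (auto simp: semiring_prime_ideal_def)
  then show ?thesis
    using that \<open>I \<subseteq> M\<close> \<open>x \<notin> M\<close> by blast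
qed

text \<open>A prime is its own radical. Conversely, an element \<open>b\<close> outside the radical
  of \<open>I\<close> is missed by some prime above \<open>I\<close>; that prime contains the whole
  radical, so its subtractivity is contradicted.\<close>

lemma subtractive_radical_iff_subtractive_prime:
  "(\<forall>I :: 's::comm_semiring_1 set. semiring_ideal I \<longrightarrow> subtractive (ideal_radical I))
     \<longleftrightarrow> (\<forall>P :: 's set. semiring_prime_ideal P \<longrightarrow> subtractive P)"
proof (intro iffI allI impI)
  fix P :: "'s set"
  assume "\<forall>I :: 's set. semiring_ideal I \<longrightarrow> subtractive (ideal_radical I)"
    and P: "semiring_prime_ideal P"
  then have "subtractive (ideal_radical P)"
    by (auto simp: semiring_prime_ideal_def)
  then show "subtractive P"
    by (simp add: ideal_radical_prime[OF P])
next
  fix I :: "'s set"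
  assume prime: "\<forall>P :: 's set. semiring_prime_ideal P \<longrightarrow> subtractive P" and I: "semiring_ideal I"
  show "subtractive (ideal_radical I)"
    unfolding subtractive_def
  proof (intro allI impI)
    fix a b assume ab: "a + b \<in> ideal_radical I \<and> a \<in> ideal_radical I"
    show "b \<in> ideal_radical I"
    proof (rule ccontr)
      assume "b \<notin> ideal_radical I"
      then obtain P where P: "semiring_prime_ideal P" "I \<subseteq> P" "b \<notin> P"
        using prime_ideal_avoiding[OF I] by blast
      then have "a + b \<in> P \<and> a \<in> P"
        using ab ideal_radical_mono[OF P(2)] ideal_radical_prime[OF P(1)] by blast
      moreover have "subtractive P"
        using prime P(1) by blast
      ultimately show False
        using P(3) unfolding subtractive_def by blast
    qed
  qed
qed

section \<open>Products of ideals\<close>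

lemma ideal_product_mult: "a \<in> I \<Longrightarrow> b \<in> J \<Longrightarrow> a * b \<in> ideal_product I J"
  unfolding ideal_product_def
  by (rule CollectI, rule exI[of _ 1], rule exI[of _ "\<lambda>_. a"], rule exI[of _ "\<lambda>_. b"]) simp

lemma semiring_ideal_product:
  assumes I: "semiring_ideal I"
  shows "semiring_ideal (ideal_product I J)"
  unfolding semiring_ideal_def
proof (intro conjI ballI allI)
  have "0 \<in> ideal_product I J"
    unfolding ideal_product_def by (auto intro!: exI[of _ 0])
  then show "ideal_product I J \<noteq> {}"
    by blast
next
  fix x y assume "x \<in> ideal_product I J" "y \<in> ideal_product I J"
  then obtain n m :: nat and a b a' b'
    where x: "x = (\<Sum>i<n. a i * b i)" "\<forall>i<n. a i \<in> I \<and> b i \<in> J"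
      and y: "y = (\<Sum>i<m. a' i * b' i)" "\<forall>i<m. a' i \<in> I \<and> b' i \<in> J"
    unfolding ideal_product_def by blast
  \<comment> \<open>Concatenation of the two families of factors.\<close>
  define c where "c i = (if i < n then a i else a' (i - n))" for i
  define d where "d i = (if i < n then b i else b' (i - n))" for i
  \<comment> \<open>Stated for every \<open>k\<close>, so that induction on the length of the second
    sum applies; \<open>m\<close> is substituted afterwards.\<close>
  have "(\<Sum>i<n + k. c i * d i) = (\<Sum>i<n. a i * b i) + (\<Sum>i<k. a' i * b' i)" for k
    by (induction k) (auto simp: c_def d_def add.assoc)
  then have "x + y = (\<Sum>i<n + m. c i * d i)"
    by (simp add: x y)
  moreover have "\<forall>i<n + m. c i \<in> I \<and> d i \<in> J"
    using x(2) y(2) by (auto simp: c_def d_def)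
  ultimately show "x + y \<in> ideal_product I J"
    unfolding ideal_product_def by blast
next
  fix s x assume "x \<in> ideal_product I J"
  then obtain n :: nat and a b where x: "x = (\<Sum>i<n. a i * b i)" "\<forall>i<n. a i \<in> I \<and> b i \<in> J"
    unfolding ideal_product_def by blast
  then have "s * x = (\<Sum>i<n. (s * a i) * b i)" "\<forall>i<n. s * a i \<in> I \<and> b i \<in> J"
    by (auto simp: sum_distrib_left mult.assoc semiring_ideal_mult_left[OF I])
  then show "s * x \<in> ideal_product I J"
    unfolding ideal_product_def by (intro CollectI exI[of _ n] exI[of _ "\<lambda>i. s * a i"] exI[of _ b]) simp
qed

lemma ideal_product_subset:
  assumes "semiring_ideal K"
  shows ideal_product_subset_left: "I \<subseteq> K \<Longrightarrow> ideal_product I J \<subseteq> K"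
    and ideal_product_subset_right: "J \<subseteq> K \<Longrightarrow> ideal_product I J \<subseteq> K"
  unfolding ideal_product_def
  by (auto intro!: semiring_ideal_sum[OF assms] intro: semiring_idealD[OF assms])

section \<open>Sums with a unique representation\<close>

text \<open>The same constant sum as in \<open>torsion_free_monoid\<close>, so that torsion-freeness
  is literally the root condition for equality.\<close>

definition multiple :: "nat \<Rightarrow> 'g::comm_monoid_add \<Rightarrow> 'g" where
  "multiple n x = (\<Sum>i<n. x)"

lemma multiple_zero [simp]: "multiple 0 x = 0"
  and multiple_Suc: "multiple (Suc n) x = multiple n x + x"
  by (simp_all add: multiple_def)

lemma multiple_add_left: "multiple (m + n) x = multiple m x + multiple n x"
  by (induction n) (simp_all add: multiple_Suc add.assoc)

lemma multiple_add_right: "multiple n (x + y) = multiple n x + multiple n y"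
  by (simp add: multiple_def sum.distrib)

lemma multiple_multiple: "multiple m (multiple n x) = multiple (m * n) x"
  by (induction m) (simp_all add: multiple_Suc multiple_add_left add.commute)

text \<open>Transitivity follows from the closure under addition and cancellation. The last condition is
  what allows an arbitrary incomparable pair to be added to the order.\<close>

definition root_closed_order :: "('g::comm_monoid_add \<Rightarrow> 'g \<Rightarrow> bool) \<Rightarrow> bool" where
  "root_closed_order R \<longleftrightarrow>
     (\<forall>x. R x x) \<and>
     (\<forall>x y z w. R x y \<longrightarrow> R z w \<longrightarrow> R (x + z) (y + w)) \<and>
     (\<forall>x y z. R (x + z) (y + z) \<longrightarrow> R x y) \<and>
     (\<forall>x y. R x y \<longrightarrow> R y x \<longrightarrow> x = y) \<and>
     (\<forall>n x y. n \<ge> 1 \<longrightarrow> R (multiple n x) (multiple n y) \<longrightarrow> R x y)"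

lemma root_closed_orderD:
  assumes "root_closed_order R"
  shows root_closed_order_refl: "R x x"
    and root_closed_order_add: "R x y \<Longrightarrow> R z w \<Longrightarrow> R (x + z) (y + w)"
    and root_closed_order_cancel: "R (x + z) (y + z) \<Longrightarrow> R x y"
    and root_closed_order_antisym: "R x y \<Longrightarrow> R y x \<Longrightarrow> x = y"
    and root_closed_order_root: "n \<ge> 1 \<Longrightarrow> R (multiple n x) (multiple n y) \<Longrightarrow> R x y"
  using assms unfolding root_closed_order_def by blast+

lemma root_closed_order_trans:
  assumes R: "root_closed_order R" and "R x y" "R y z"
  shows "R x z"
  using root_closed_order_add[OF R assms(2,3)] root_closed_order_cancel[OF R, of x y z]
  by (simp add: add.commute)

lemma root_closed_order_multiple:
  assumes "root_closed_order R" and "R x y"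
  shows "R (multiple n x) (multiple n y)"
  by (induction n)
    (simp_all add: multiple_Suc root_closed_order_refl[OF assms(1)]
      root_closed_order_add[OF assms(1)] assms(2))

text \<open>Equality is the order from which the construction starts: cancellation and
  torsion-freeness of the monoid supply the third and the last condition.\<close>

lemma root_closed_order_eq:
  assumes "torsion_free_monoid TYPE('g::{comm_monoid_add, cancel_semigroup_add})"
  shows "root_closed_order ((=) :: 'g \<Rightarrow> 'g \<Rightarrow> bool)"
  using assms unfolding root_closed_order_def torsion_free_monoid_def multiple_def by auto

text \<open>The order generated by \<open>R\<close> and the new relation \<open>a\<close> below
  \<open>b\<close>. In the group of differences it says that \<open>k (y - x)\<close> is at least
  \<open>n (b - a)\<close>, written without subtraction; the factor \<open>k\<close> makes the
  result closed under roots.\<close>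

definition adjoin_pair :: "'g \<Rightarrow> 'g \<Rightarrow> ('g::comm_monoid_add \<Rightarrow> 'g \<Rightarrow> bool) \<Rightarrow> 'g \<Rightarrow> 'g \<Rightarrow> bool" where
  "adjoin_pair a b R x y \<longleftrightarrow>
     (\<exists>k\<ge>1. \<exists>n. R (multiple k x + multiple n b) (multiple k y + multiple n a))"

lemma adjoin_pairI:
  "k \<ge> 1 \<Longrightarrow> R (multiple k x + multiple n b) (multiple k y + multiple n a) \<Longrightarrow> adjoin_pair a b R x y"
  by (auto simp: adjoin_pair_def)

text \<open>The assumption \<open>\<not> R b a\<close> enters through antisymmetry: if the new
  relation identified two distinct elements, a positive multiple of \<open>b\<close> would lie below
  that of \<open>a\<close>, and root closure of \<open>R\<close> would give
  \<open>R b a\<close>.\<close>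

lemma root_closed_order_adjoin_pair:
  assumes R: "root_closed_order R" and "\<not> R b a"
  shows "root_closed_order (adjoin_pair a b R)"
proof -
  \<comment> \<open>Scaling the first relation by \<open>k'\<close> and the second by
    \<open>k\<close> gives both the common factor \<open>k * k'\<close>, after which they can be
    added.\<close>
  have combine: "R (multiple (k * k') (x + z) + multiple (k' * n + k * n') b)
                   (multiple (k * k') (y + w) + multiple (k' * n + k * n') a)"
    if "R (multiple k x + multiple n b) (multiple k y + multiple n a)"
      and "R (multiple k' z + multiple n' b) (multiple k' w + multiple n' a)"
    for k k' n n' x y z w
    using root_closed_order_add[OF R root_closed_order_multiple[OF R that(1), of k']
        root_closed_order_multiple[OF R that(2), of k]]
    by (simp add: multiple_add_right multiple_add_left multiple_multiple ac_simps)
  have refl: "adjoin_pair a b R x x" for x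
    by (rule adjoin_pairI[of 1 _ _ 0]) (auto simp: root_closed_order_refl[OF R])
  have add: "adjoin_pair a b R (x + z) (y + w)"
    if "adjoin_pair a b R x y" "adjoin_pair a b R z w" for x y z w
  proof -
    obtain k n k' n' where "k \<ge> 1" "k' \<ge> 1"
      and "R (multiple k x + multiple n b) (multiple k y + multiple n a)"
      and "R (multiple k' z + multiple n' b) (multiple k' w + multiple n' a)"
      using \<open>adjoin_pair a b R x y\<close> \<open>adjoin_pair a b R z w\<close> unfolding adjoin_pair_def by blast
    then show ?thesis
      using combine by (intro adjoin_pairI[of "k * k'"]) auto
  qed
  have cancel: "adjoin_pair a b R x y" if xy: "adjoin_pair a b R (x + z) (y + z)" for x y z
  proof -
    obtain k n where "k \<ge> 1"
      and kn: "R (multiple k (x + z) + multiple n b) (multiple k (y + z) + multiple n a)"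
      using xy unfolding adjoin_pair_def by blast
    have "R (multiple k x + multiple n b) (multiple k y + multiple n a)"
      by (rule root_closed_order_cancel[OF R, of _ "multiple k z"])
        (use kn in \<open>simp add: multiple_add_right ac_simps\<close>)
    then show ?thesis
      using \<open>k \<ge> 1\<close> by (rule adjoin_pairI[rotated])
  qed
  have root: "adjoin_pair a b R x y"
    if "m \<ge> 1" and xy: "adjoin_pair a b R (multiple m x) (multiple m y)" for m x y
  proof -
    obtain k n where "k \<ge> 1"
      and "R (multiple (k * m) x + multiple n b) (multiple (k * m) y + multiple n a)"
      using xy unfolding adjoin_pair_def multiple_multiple by blast
    then show ?thesis
      using \<open>m \<ge> 1\<close> by (intro adjoin_pairI[of "k * m"]) auto
  qed
  have antisym: "x = y" if xy: "adjoin_pair a b R x y" "adjoin_pair a b R y x" for x y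
  proof -
    obtain k n k' n' where k: "k \<ge> 1" "k' \<ge> 1"
      and 1: "R (multiple k x + multiple n b) (multiple k y + multiple n a)"
      and 2: "R (multiple k' y + multiple n' b) (multiple k' x + multiple n' a)"
      using xy unfolding adjoin_pair_def by blast
    \<comment> \<open>Adding the two opposite relations leaves
      \<open>multiple (k * k') (x + y)\<close> on both sides, which cancels.\<close>
    have "R (multiple (k' * n + k * n') b) (multiple (k' * n + k * n') a)"
      by (rule root_closed_order_cancel[OF R, of _ "multiple (k * k') (x + y)"])
        (use combine[OF 1 2] in \<open>simp add: ac_simps\<close>)
    then have "\<not> k' * n + k * n' \<ge> 1"
      using root_closed_order_root[OF R] \<open>\<not> R b a\<close> by blast
    then have "k' * n + k * n' = 0"
      by linarith
    \<comment> \<open>Since \<open>k\<close> and \<open>k'\<close> are positive, the new pair was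
      used in neither relation, so both already come from \<open>R\<close>.\<close>
    then have "n = 0" "n' = 0"
      using k by auto
    then have "R (multiple k x) (multiple k y)" "R (multiple k' y) (multiple k' x)"
      using 1 2 by simp_all
    then have "R x y" "R y x"
      using root_closed_order_root[OF R k(1)] root_closed_order_root[OF R k(2)] by blast+
    then show ?thesis
      by (rule root_closed_order_antisym[OF R])
  qed
  show ?thesis
    unfolding root_closed_order_def using refl add cancel antisym root by blast
qed

lemma adjoin_pair_extends: "R x y \<Longrightarrow> adjoin_pair a b R x y"
  by (rule adjoin_pairI[of 1 _ _ 0]) (auto simp: multiple_def)

lemma adjoin_pair_pair:
  assumes "root_closed_order R"
  shows "adjoin_pair a b R a b"
  by (rule adjoin_pairI[of 1 _ _ 1])
    (auto simp: add.commute root_closed_order_refl[OF assms])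

text \<open>The pairs are treated one at a time. For \<open>(a, b)\<close>, either
  \<open>R b a\<close> holds already or \<open>a\<close> can be put below \<open>b\<close>; earlier
  comparisons survive because the order only grows.\<close>

lemma root_closed_order_total_on_finite:
  assumes tf: "torsion_free_monoid TYPE('g::{comm_monoid_add, cancel_semigroup_add})"
    and "finite (D :: ('g \<times> 'g) set)"
  shows "\<exists>R :: 'g \<Rightarrow> 'g \<Rightarrow> bool. root_closed_order R \<and> (\<forall>(x, y)\<in>D. R x y \<or> R y x)"
  using assms(2)
proof (induction D rule: finite_induct)
  case empty
  show ?case
    using root_closed_order_eq[OF tf] by auto
next
  case (insert p D)
  then obtain R :: "'g \<Rightarrow> 'g \<Rightarrow> bool"
    where R: "root_closed_order R" and tot: "\<forall>(x, y)\<in>D. R x y \<or> R y x"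
    by blast
  obtain a b where p: "p = (a, b)"
    by fastforce
  show ?case
  proof (cases "R b a")
    case True
    then show ?thesis
      using R tot p by auto
  next
    case False
    then show ?thesis
      using root_closed_order_adjoin_pair[OF R False] adjoin_pair_pair[OF R, of a b] tot p
      by (intro exI[of _ "adjoin_pair a b R"]) (auto dest: adjoin_pair_extends[where a = a and b = b])
  qed
qed

section \<open>Least elements and unique sums\<close>

lemma root_closed_order_least:
  assumes R: "root_closed_order R" and "finite A" "A \<noteq> {}"
    and "\<And>x y. x \<in> A \<Longrightarrow> y \<in> A \<Longrightarrow> R x y \<or> R y x"
  shows "\<exists>a\<in>A. \<forall>x\<in>A. R a x"
  using assms(2-)
proof (induction A rule: finite_ne_induct)
  case (singleton x)
  then show ?case
    using root_closed_order_refl[OF R] by blast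
next
  case (insert x A)
  then obtain a where a: "a \<in> A" "\<forall>y\<in>A. R a y"
    by (metis insertCI)
  have "R a x \<or> R x a"
    using insert.prems a(1) by blast
  then show ?case
    using a root_closed_order_trans[OF R] root_closed_order_refl[OF R] by blast
qed

text \<open>The least elements \<open>a\<close> of \<open>A\<close> and \<open>b\<close> of
  \<open>B\<close> work: in any other pair neither entry is smaller, so an equal sum forces equality
  in both. Only comparisons within \<open>A\<close> and within \<open>B\<close> are made, hence the
  finite set of pairs passed to the previous construction.\<close>

lemma unique_sum:
  fixes A B :: "'g::{comm_monoid_add, cancel_semigroup_add} set"
  assumes tf: "torsion_free_monoid TYPE('g)"
    and A: "finite A" "A \<noteq> {}" and B: "finite B" "B \<noteq> {}"
  obtains a b where "a \<in> A" "b \<in> B"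
    "\<And>x y. x \<in> A \<Longrightarrow> y \<in> B \<Longrightarrow> x + y = a + b \<Longrightarrow> x = a \<and> y = b"
proof -
  obtain R :: "'g \<Rightarrow> 'g \<Rightarrow> bool"
    where R: "root_closed_order R" and tot: "\<forall>(x, y)\<in>A \<times> A \<union> B \<times> B. R x y \<or> R y x"
    using root_closed_order_total_on_finite[OF tf, of "A \<times> A \<union> B \<times> B"] A B by auto
  obtain a where a: "a \<in> A" "\<forall>x\<in>A. R a x"
    using root_closed_order_least[OF R A] tot by auto
  obtain b where b: "b \<in> B" "\<forall>x\<in>B. R b x"
    using root_closed_order_least[OF R B] tot by auto
  show ?thesis
  proof (rule that[OF a(1) b(1)])
    fix x y assume xy: "x \<in> A" "y \<in> B" "x + y = a + b"
    \<comment> \<open>Adding \<open>y\<close> to \<open>R a x\<close> and replacing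
      \<open>x + y\<close> by \<open>a + b\<close> bounds \<open>y\<close> by \<open>b\<close> after
      cancelling \<open>a\<close>.\<close>
    then have "R (y + a) (b + a)"
      using root_closed_order_add[OF R, of a x y y] root_closed_order_refl[OF R] a(2)
      by (simp add: add.commute)
    then have "y = b"
      using root_closed_order_cancel[OF R] root_closed_order_antisym[OF R] b(2) xy(2) by blast
    then show "x = a \<and> y = b"
      using xy(3) by (simp add: add_right_cancel)
  qed
qed

section \<open>Content ideals\<close>

lemma semiring_ideal_content: "semiring_ideal (content_ideal f)"
  unfolding content_ideal_def by (rule semiring_ideal_hull)

text \<open>Coefficients off the support are 0, which lies in every ideal, so all exponents can be
  treated uniformly.\<close>

lemma lookup_in_content_ideal: "Poly_Mapping.lookup f k \<in> content_ideal f"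
proof (cases "k \<in> Poly_Mapping.keys f")
  case True
  then show ?thesis
    unfolding content_ideal_def by (intro hull_inc imageI)
next
  case False
  then show ?thesis
    by (simp add: in_keys_iff semiring_ideal_zero[OF semiring_ideal_content])
qed

lemma content_ideal_subset_iff:
  assumes "semiring_ideal I"
  shows "content_ideal f \<subseteq> I \<longleftrightarrow> (\<forall>k. Poly_Mapping.lookup f k \<in> I)"
proof
  assume "\<forall>k. Poly_Mapping.lookup f k \<in> I"
  then show "content_ideal f \<subseteq> I"
    unfolding content_ideal_def by (intro hull_minimal assms) auto
next
  assume "content_ideal f \<subseteq> I"
  then show "\<forall>k. Poly_Mapping.lookup f k \<in> I"
    using lookup_in_content_ideal[of f] by (simp add: subset_iff)
qed

text \<open>Replaces the nested \<open>Sum_any\<close> of the convolution by one finite sum over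
  pairs of exponents, from which a single term can be split off.\<close>

lemma lookup_mult_sum:
  fixes f g :: "'g::comm_monoid_add \<Rightarrow>\<^sub>0 's::comm_semiring_1"
  shows "Poly_Mapping.lookup (f * g) k =
    (\<Sum>(i, j)\<in>{(i, j). i \<in> Poly_Mapping.keys f \<and> j \<in> Poly_Mapping.keys g \<and> i + j = k}.
       Poly_Mapping.lookup f i * Poly_Mapping.lookup g j)"
proof -
  have inner: "(\<Sum>j. Poly_Mapping.lookup g j when k = i + j) =
      (\<Sum>j\<in>Poly_Mapping.keys g. Poly_Mapping.lookup g j when k = i + j)" for i
    by (rule Sum_any.expand_superset) (auto simp: in_keys_iff)
  have "Poly_Mapping.lookup (f * g) k =
      (\<Sum>i\<in>Poly_Mapping.keys f. Poly_Mapping.lookup f i *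
         (\<Sum>j\<in>Poly_Mapping.keys g. Poly_Mapping.lookup g j when k = i + j))"
    unfolding lookup_mult inner
    by (rule Sum_any.expand_superset) (auto simp: in_keys_iff)
  also have "\<dots> = (\<Sum>(i, j)\<in>Poly_Mapping.keys f \<times> Poly_Mapping.keys g.
      if i + j = k then Poly_Mapping.lookup f i * Poly_Mapping.lookup g j else 0)"
    unfolding sum_distrib_left sum.cartesian_product by (rule sum.cong) (auto simp: when_def)
  also have "\<dots> = (\<Sum>(i, j)\<in>{(i, j). i \<in> Poly_Mapping.keys f \<and> j \<in> Poly_Mapping.keys g \<and> i + j = k}.
       Poly_Mapping.lookup f i * Poly_Mapping.lookup g j)"
    by (rule sum.mono_neutral_cong_right) (auto split: if_splits)
  finally show ?thesis .
qed

lemma content_ideal_mult_subset: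
  fixes f g :: "'g::comm_monoid_add \<Rightarrow>\<^sub>0 's::comm_semiring_1"
  shows "content_ideal (f * g) \<subseteq> ideal_product (content_ideal f) (content_ideal g)"
  unfolding content_ideal_subset_iff[OF semiring_ideal_product[OF semiring_ideal_content]] lookup_mult_sum
  by (auto intro!: semiring_ideal_sum semiring_ideal_product semiring_ideal_content
      ideal_product_mult lookup_in_content_ideal)

text \<open>A form of Gauss's lemma modulo a subtractive prime.\<close>

lemma content_ideal_mult_prime:
  fixes f g :: "'g::{comm_monoid_add, cancel_semigroup_add} \<Rightarrow>\<^sub>0 's::comm_semiring_1"
  assumes tf: "torsion_free_monoid TYPE('g)"
    and P: "semiring_prime_ideal P" and sub: "subtractive P"
    and fg: "content_ideal (f * g) \<subseteq> P"
  shows "content_ideal f \<subseteq> P \<or> content_ideal g \<subseteq> P"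
proof (rule ccontr)
  have I: "semiring_ideal P"
    using P by (simp add: semiring_prime_ideal_def)
  \<comment> \<open>\<open>A\<close> and \<open>B\<close> are the supports of \<open>f\<close> and
    \<open>g\<close> modulo \<open>P\<close>.\<close>
  define A where "A = {k. Poly_Mapping.lookup f k \<notin> P}"
  define B where "B = {k. Poly_Mapping.lookup g k \<notin> P}"
  have AB: "A \<subseteq> Poly_Mapping.keys f" "B \<subseteq> Poly_Mapping.keys g"
    using semiring_ideal_zero[OF I] by (auto simp: A_def B_def in_keys_iff)
  assume "\<not> (content_ideal f \<subseteq> P \<or> content_ideal g \<subseteq> P)"
  then have "A \<noteq> {}" "B \<noteq> {}"
    by (auto simp: content_ideal_subset_iff[OF I] A_def B_def)
  then obtain a b where ab: "a \<in> A" "b \<in> B"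
    and uniq: "\<And>x y. x \<in> A \<Longrightarrow> y \<in> B \<Longrightarrow> x + y = a + b \<Longrightarrow> x = a \<and> y = b"
    using unique_sum[OF tf] finite_subset[OF AB(1)] finite_subset[OF AB(2)]
    by (metis finite_keys)
  let ?T = "{(i, j). i \<in> Poly_Mapping.keys f \<and> j \<in> Poly_Mapping.keys g \<and> i + j = a + b}"
  let ?h = "\<lambda>(i, j). Poly_Mapping.lookup f i * Poly_Mapping.lookup g j"
  have "finite ?T"
    by (rule finite_subset[of _ "Poly_Mapping.keys f \<times> Poly_Mapping.keys g"]) auto
  moreover have "(a, b) \<in> ?T"
    using ab AB by auto
  ultimately have "sum ?h ?T = ?h (a, b) + sum ?h (?T - {(a, b)})"
    by (rule sum.remove)
  \<comment> \<open>The part that will be shown to lie in \<open>P\<close> is put first, to match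
    the shape of \<open>subtractive\<close>.\<close>
  then have "Poly_Mapping.lookup (f * g) (a + b) = sum ?h (?T - {(a, b)}) + ?h (a, b)"
    unfolding lookup_mult_sum by (rule trans[OF _ add.commute])
  moreover have "Poly_Mapping.lookup (f * g) (a + b) \<in> P"
    using fg by (rule subsetD) (rule lookup_in_content_ideal)
  moreover have "sum ?h (?T - {(a, b)}) \<in> P"
  proof (rule semiring_ideal_sum[OF I])
    fix p assume p: "p \<in> ?T - {(a, b)}"
    then obtain x y where xy: "p = (x, y)" "x + y = a + b" "(x, y) \<noteq> (a, b)"
      by auto
    \<comment> \<open>By uniqueness, every remaining pair leaves \<open>A\<close> or
      \<open>B\<close>, so one of its two coefficients is in \<open>P\<close>.\<close>
    then have "x \<notin> A \<or> y \<notin> B"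
      using uniq[of x y] by blast
    then show "?h p \<in> P"
      using xy(1) by (auto simp: A_def B_def semiring_idealD[OF I])
  qed
  ultimately have "?h (a, b) \<in> P"
    using sub[unfolded subtractive_def, rule_format,
        of "sum ?h (?T - {(a, b)})" "?h (a, b)"] by simp
  then show False
    using P ab by (auto simp: semiring_prime_ideal_def A_def B_def)
qed

text \<open>Membership in the radical is tested on primes: a prime above the content of
  \<open>f * g\<close> contains one of the two contents, hence their product.\<close>

lemma ideal_product_content_subset_radical:
  fixes f g :: "'g::{comm_monoid_add, cancel_semigroup_add} \<Rightarrow>\<^sub>0 's::comm_semiring_1"
  assumes tf: "torsion_free_monoid TYPE('g)"
    and prime: "\<And>P :: 's set. semiring_prime_ideal P \<Longrightarrow> subtractive P"
  shows "ideal_product (content_ideal f) (content_ideal g) \<subseteq> ideal_radical (content_ideal (f * g))"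
proof (rule subsetI, rule ccontr)
  fix y assume y: "y \<in> ideal_product (content_ideal f) (content_ideal g)"
    and "y \<notin> ideal_radical (content_ideal (f * g))"
  then obtain P where P: "semiring_prime_ideal P" "content_ideal (f * g) \<subseteq> P" "y \<notin> P"
    using prime_ideal_avoiding[OF semiring_ideal_content] by blast
  have "content_ideal f \<subseteq> P \<or> content_ideal g \<subseteq> P"
    by (rule content_ideal_mult_prime[OF tf P(1) prime[OF P(1)] P(2)])
  moreover have "semiring_ideal P"
    using P(1) by (simp add: semiring_prime_ideal_def)
  ultimately show False
    using y P(3) ideal_product_subset_left[of P "content_ideal f" "content_ideal g"]
      ideal_product_subset_right[of P "content_ideal g" "content_ideal f"] by auto
qed

text \<open>The polynomials \<open>f\<close> and \<open>g\<close> both have the coefficient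
  \<open>b\<close>, while every coefficient of \<open>f * g\<close> involves \<open>a\<close> or
  \<open>a + b\<close>. The condition \<open>e \<noteq> 0\<close> keeps \<open>b\<close> from
  merging with the other coefficient.\<close>

lemma subtractive_prime_if_content_radical:
  fixes P :: "'s::comm_semiring_1 set" and e :: "'g::comm_monoid_add"
  assumes P: "semiring_prime_ideal P" and "e \<noteq> 0"
    and content: "\<And>f g :: 'g \<Rightarrow>\<^sub>0 's.
      ideal_product (content_ideal f) (content_ideal g) \<subseteq> ideal_radical (content_ideal (f * g))"
  shows "subtractive P"
  unfolding subtractive_def
proof (intro allI impI)
  fix a b assume ab: "a + b \<in> P \<and> a \<in> P"
  have I: "semiring_ideal P"
    using P by (simp add: semiring_prime_ideal_def)
  define f :: "'g \<Rightarrow>\<^sub>0 's" where "f = Poly_Mapping.single 0 b + Poly_Mapping.single e a"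
  define g :: "'g \<Rightarrow>\<^sub>0 's" where "g = Poly_Mapping.single 0 (a + b) + Poly_Mapping.single e b"
  \<comment> \<open>The middle coefficient \<open>b * b + a * (a + b)\<close> is regrouped, because
    \<open>b * b\<close> is not yet known to lie in \<open>P\<close>.\<close>
  have "f * g = Poly_Mapping.single 0 (b * (a + b))
      + Poly_Mapping.single e (b * (a + b) + a * a) + Poly_Mapping.single (e + e) (a * b)"
    unfolding f_def g_def
    by (simp add: distrib_left distrib_right mult_single single_add ac_simps)
  moreover have "b * (a + b) \<in> P" "b * (a + b) + a * a \<in> P" "a * b \<in> P"
    using ab by (simp_all add: semiring_idealD[OF I])
  \<comment> \<open>Should some of the exponents \<open>0\<close>, \<open>e\<close>,
    \<open>e + e\<close> coincide, the coefficients involved add up and stay in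
    \<open>P\<close>.\<close>
  ultimately have "content_ideal (f * g) \<subseteq> P"
    by (auto simp: content_ideal_subset_iff[OF I] lookup_add lookup_single when_def
        semiring_ideal_zero[OF I] semiring_ideal_add[OF I])
  then have rad: "ideal_radical (content_ideal (f * g)) \<subseteq> P"
    using ideal_radical_mono ideal_radical_prime[OF P] by blast
  have "Poly_Mapping.lookup f 0 = b" "Poly_Mapping.lookup g e = b"
    using \<open>e \<noteq> 0\<close> by (simp_all add: f_def g_def lookup_add lookup_single when_def)
  then have "b * b \<in> ideal_product (content_ideal f) (content_ideal g)"
    using ideal_product_mult[OF lookup_in_content_ideal[of f 0] lookup_in_content_ideal[of g e]]
    by simp
  then have "b * b \<in> P"
    using content rad by blast
  then show "b \<in> P"
    using P by (auto simp: semiring_prime_ideal_def)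
qed

text \<open>The monoid has to be nontrivial: over the trivial one all contents are principal and (1)
  always holds, whereas (3) fails for the natural numbers, where all numbers except 1 form a prime
  ideal that is not subtractive.\<close>

theorem theorem3p11:
  assumes torsion_free: "torsion_free_monoid TYPE('g::{comm_monoid_add, cancel_semigroup_add})"
    and nontrivial: "\<exists>g :: 'g. g \<noteq> 0"
  shows "((\<forall>f g :: 'g \<Rightarrow>\<^sub>0 's::comm_semiring_1.
             content_ideal (f * g) \<subseteq> ideal_product (content_ideal f) (content_ideal g) \<and>
             ideal_product (content_ideal f) (content_ideal g) \<subseteq> ideal_radical (content_ideal (f * g)))
          \<longleftrightarrow> (\<forall>I :: 's set. semiring_ideal I \<longrightarrow> subtractive (ideal_radical I)))
       \<and> ((\<forall>I :: 's set. semiring_ideal I \<longrightarrow> subtractive (ideal_radical I))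
          \<longleftrightarrow> (\<forall>P :: 's set. semiring_prime_ideal P \<longrightarrow> subtractive P))"
  \<comment> \<open>Statement (2) is replaced by (3) throughout, which leaves the equivalence of (1)
    and (3) and a trivial second conjunct.\<close>
  unfolding subtractive_radical_iff_subtractive_prime
proof (intro conjI iffI allI impI)
  fix P :: "'s set"
  assume content: "\<forall>f g :: 'g \<Rightarrow>\<^sub>0 's.
      content_ideal (f * g) \<subseteq> ideal_product (content_ideal f) (content_ideal g) \<and>
      ideal_product (content_ideal f) (content_ideal g) \<subseteq> ideal_radical (content_ideal (f * g))"
    and P: "semiring_prime_ideal P"
  obtain e :: 'g where "e \<noteq> 0"
    using nontrivial by blast
  then show "subtractive P"
    by (rule subtractive_prime_if_content_radical[OF P]) (use content in blast)
next
  fix f g :: "'g \<Rightarrow>\<^sub>0 's"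
  show "content_ideal (f * g) \<subseteq> ideal_product (content_ideal f) (content_ideal g)"
    by (rule content_ideal_mult_subset)
  assume "\<forall>P :: 's set. semiring_prime_ideal P \<longrightarrow> subtractive P"
  then show "ideal_product (content_ideal f) (content_ideal g) \<subseteq> ideal_radical (content_ideal (f * g))"
    by (intro ideal_product_content_subset_radical[OF torsion_free]) blast
qed simp_all

end
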